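(* Let $n\in\mathbb{N}$ and $M\in\mathbb{R}^{2n\times 2n}$. (a) $M\in A_{2n}^o$ if and only if $$M=\mathcal{X}_{2n}\begin{pmatrix}\mathcal{O}_n & V^T\\ W & \mathcal{O}_n\end{pmatrix}\mathcal{X}_{2n}$$ where $V,W\in\mathbb{R}^{n\times n}$ have row sum $0$, i.e. $V1_n=0_n$ and $W1_n=0_n$. (b) $M\in B_{2n}^o$ if and only if $$M=\mathcal{X}_{2n}\begin{pmatrix}Y & \mathcal{O}_n\\ \mathcal{O}_n & Z\end{pmatrix}\mathcal{X}_{2n}$$ where $Y\in S_n^o$ and $Z\in\mathbb{R}^{n\times n}$. (c) The matrix $\mathcal{E}_{2n}$ satisfies $$\mathcal{E}_{2n}=\mathcal{X}_{2n}\begin{pmatrix}2\mathcal{E}_n & \mathcal{O}_n\\ \mathcal{O}_n & \mathcal{O}_n\end{pmatrix}\mathcal{X}_{2n}.$$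
   Context: An $m\times m$ real matrix $M$ is a semimagic square of weight $w\in\mathbb{R}$ if each of its rows and each of its columns sums to $mw$. A semimagic square $M$ of weight $w$ is associated if $M_{ij}+M_{m+1-i,m+1-j}=2w$ for all $i,j\in\{1,\dots,m\}$, and balanced if $M_{ij}=M_{m+1-i,m+1-j}$ for all $i,j$. $S_m^o$, $A_m^o$, $B_m^o$ denote the sets of $m\times m$ semimagic, associated semimagic, and balanced semimagic square matrices of weight $0$, respectively. $1_m\in\mathbb{R}^m$ is the column vector with all entries $1$, $0_m\in\mathbb{R}^m$ the null vector, $\mathcal{E}_m$ the $m\times m$ matrix with all entries $1$, $\mathcal{O}_m$ the $m\times m$ null matrix, $\mathcal{I}_m$ the unit matrix, and $\mathcal{J}_m=(\delta_{i,m+1-j})_{i,j=1}^m$ the matrix with ones on the antidiagonal and zeros elsewhere. Furthermore $$\mathcal{X}_{2n}=\frac1{\sqrt2}\begin{pmatrix}\mathcal{I}_n & \mathcal{J}_n\\ \mathcal{J}_n & -\mathcal{I}_n\end{pmatrix}\in\mathbb{R}^{2n\times2n}.$$ *)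

theory Defs
  imports Complex_Main "Jordan_Normal_Form.Matrix"
begin

text \<open>Matrix entries are indexed from 0, so the 1-based index reflection
  i to m + 1 - i becomes i to m - 1 - i for i < m.\<close>

definition semimagic :: "nat \<Rightarrow> real \<Rightarrow> real mat \<Rightarrow> bool" where
  "semimagic m w M \<longleftrightarrow> M \<in> carrier_mat m m \<and>
     (\<forall>i<m. (\<Sum>j<m. M $$ (i, j)) = real m * w) \<and>
     (\<forall>j<m. (\<Sum>i<m. M $$ (i, j)) = real m * w)"

definition associated :: "nat \<Rightarrow> real \<Rightarrow> real mat \<Rightarrow> bool" where
  "associated m w M \<longleftrightarrow>
     (\<forall>i<m. \<forall>j<m. M $$ (i, j) + M $$ (m - 1 - i, m - 1 - j) = 2 * w)"

definition balanced :: "nat \<Rightarrow> real mat \<Rightarrow> bool" where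
  "balanced m M \<longleftrightarrow>
     (\<forall>i<m. \<forall>j<m. M $$ (i, j) = M $$ (m - 1 - i, m - 1 - j))"

definition S0 :: "nat \<Rightarrow> real mat set" where
  "S0 m = {M. semimagic m 0 M}"

definition A0 :: "nat \<Rightarrow> real mat set" where
  "A0 m = {M. semimagic m 0 M \<and> associated m 0 M}"

definition B0 :: "nat \<Rightarrow> real mat set" where
  "B0 m = {M. semimagic m 0 M \<and> balanced m M}"

definition ones_vec :: "nat \<Rightarrow> real vec" where
  "ones_vec m = vec m (\<lambda>_. 1)"

definition ones_mat :: "nat \<Rightarrow> real mat" where
  "ones_mat m = mat m m (\<lambda>_. 1)"

definition J_mat :: "nat \<Rightarrow> real mat" where
  "J_mat m = mat m m (\<lambda>(i, j). if i + j + 1 = m then 1 else 0)"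

definition X_mat :: "nat \<Rightarrow> real mat" where
  \<comment> \<open>The argument is half the size: this is the 2n by 2n matrix.\<close>
  "X_mat n = (1 / sqrt 2) \<cdot>\<^sub>m
     four_block_mat (1\<^sub>m n) (J_mat n) (J_mat n) (- 1\<^sub>m n)"

end

theory Submission imports Defs begin

text \<open>
  Write \<open>X\<close> for the block matrix \<open>X_mat n\<close>. It is symmetric and \<open>X * X = 1\<close>, so every
  \<open>M\<close> of size \<open>2 * n\<close> is \<open>X * N * X\<close> for exactly one \<open>N\<close>, namely \<open>N = X * M * X\<close>. The first \<open>n\<close>
  columns of \<open>X\<close> span the symmetric vectors and the last \<open>n\<close> the antisymmetric ones, that is, the
  two eigenspaces of the reversal \<open>J\<close> of size \<open>2 * n\<close>: if \<open>D\<close> denotes the block diagonal matrix with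
  blocks \<open>1\<close> and \<open>-1\<close>, then \<open>J = X * D * X\<close> (lemma \<open>J_mat_eq_X_conj\<close>). The theorem comes from reading each condition on
  \<open>M\<close> in these coordinates.

  Balance says that \<open>J * M * J = M\<close> and association with weight \<open>0\<close> that \<open>J * M * J = - M\<close>. For
  \<open>N\<close> these become \<open>D * N * D = N\<close> and \<open>D * N * D = - N\<close>. Conjugation by \<open>D\<close> changes the sign of
  the two off-diagonal blocks only, so balance kills these blocks and association kills the two
  diagonal ones (lemmas \<open>balanced_X_mat_conj_iff\<close> and \<open>associated_X_mat_conj_iff\<close>).

  The semimagic condition of weight \<open>0\<close> says that \<open>M\<close> and its transpose annihilate the all-ones
  vector. This vector is symmetric, and \<open>X\<close> maps it to \<open>sqrt 2\<close> times the vector with \<open>n\<close> ones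
  followed by \<open>n\<close> zeros. The condition therefore concerns only the first block column of \<open>N\<close>, whose
  rows must sum to \<open>0\<close>, and its first block row, whose columns must sum to \<open>0\<close>
  (lemma \<open>semimagic_X_mat_conj_iff\<close>). The lower right block stays free. The column condition on the upper right block is a row condition on
  its transpose, which is why \<open>V\<close> enters the associated case transposed.

  For the all-ones matrix, the coordinates are verified by multiplying out, since the reversal
  fixes that matrix on either side.
\<close>

section \<open>The reversal matrix\<close>

lemma J_mat_carrier [simp]: "J_mat m \<in> carrier_mat m m"
  by (simp add: J_mat_def)

lemma J_mat_dim [simp]: "dim_row (J_mat m) = m" "dim_col (J_mat m) = m"
  by (simp_all add: J_mat_def)

lemma J_mat_index:
  "i < m \<Longrightarrow> j < m \<Longrightarrow> J_mat m $$ (i, j) = (if j = m - 1 - i then 1 else 0)"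
  by (auto simp: J_mat_def)

lemma J_mat_transpose [simp]: "transpose_mat (J_mat m) = J_mat m"
proof (rule eq_matI)
  fix i j
  assume "i < dim_row (J_mat m)" "j < dim_col (J_mat m)"
  then have "i < m" "j < m" by simp_all
  then show "transpose_mat (J_mat m) $$ (i, j) = J_mat m $$ (i, j)"
    by (auto simp: J_mat_index)
qed simp_all

lemma J_mat_mult:
  assumes "A \<in> carrier_mat m k"
  shows "J_mat m * A = mat m k (\<lambda>(i, j). A $$ (m - 1 - i, j))"
proof (rule eq_matI)
  fix i j
  assume "i < dim_row (mat m k (\<lambda>(i, j). A $$ (m - 1 - i, j)))"
    and "j < dim_col (mat m k (\<lambda>(i, j). A $$ (m - 1 - i, j)))"
  then have ij: "i < m" "j < k" by auto
  have "(J_mat m * A) $$ (i, j) = (\<Sum>l = 0..<m. J_mat m $$ (i, l) * A $$ (l, j))"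
    using ij assms by (simp add: scalar_prod_def)
  also have "\<dots> = (\<Sum>l = 0..<m. if l = m - 1 - i then A $$ (l, j) else 0)"
    by (rule sum.cong) (use ij in \<open>auto simp: J_mat_index\<close>)
  also have "\<dots> = A $$ (m - 1 - i, j)"
    using ij by (subst sum.delta) auto
  finally show "(J_mat m * A) $$ (i, j) = mat m k (\<lambda>(i, j). A $$ (m - 1 - i, j)) $$ (i, j)"
    using ij by simp
qed (use assms in auto)

lemma mult_J_mat:
  assumes "A \<in> carrier_mat k m"
  shows "A * J_mat m = mat k m (\<lambda>(i, j). A $$ (i, m - 1 - j))"
proof -
  have "A * J_mat m = transpose_mat (J_mat m * transpose_mat A)"
    using assms by (subst transpose_mult[of _ m m _ k]) auto
  also have "\<dots> = mat k m (\<lambda>(i, j). A $$ (i, m - 1 - j))"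
    using assms by (subst J_mat_mult[of _ m k]) (auto intro!: eq_matI)
  finally show ?thesis .
qed

lemma J_mat_square [simp]: "J_mat m * J_mat m = 1\<^sub>m m"
proof -
  have "J_mat m * J_mat m = mat m m (\<lambda>(i, j). J_mat m $$ (m - 1 - i, j))"
    by (rule J_mat_mult) simp
  also have "\<dots> = 1\<^sub>m m"
    by (rule eq_matI) (auto simp: J_mat_index)
  finally show ?thesis .
qed

lemma J_mat_conj:
  assumes "M \<in> carrier_mat m m"
  shows "J_mat m * M * J_mat m = mat m m (\<lambda>(i, j). M $$ (m - 1 - i, m - 1 - j))"
proof -
  have "J_mat m * M \<in> carrier_mat m m"
    using assms by (intro mult_carrier_mat[of _ m m]) simp_all
  then have "J_mat m * M * J_mat m = mat m m (\<lambda>(i, j). (J_mat m * M) $$ (i, m - 1 - j))"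
    by (rule mult_J_mat)
  also have "\<dots> = mat m m (\<lambda>(i, j). M $$ (m - 1 - i, m - 1 - j))"
    unfolding J_mat_mult[OF assms] by (intro eq_matI) simp_all
  finally show ?thesis .
qed

text \<open>Reflecting both indices is conjugation by the reversal, which turns the two entrywise
  symmetries into eigenvalue equations for that conjugation.\<close>

lemma balanced_iff_J_mat_conj:
  assumes "M \<in> carrier_mat m m"
  shows "balanced m M \<longleftrightarrow> J_mat m * M * J_mat m = M"
proof -
  have "J_mat m * M * J_mat m = M \<longleftrightarrow>
      (\<forall>i<m. \<forall>j<m. M $$ (m - 1 - i, m - 1 - j) = M $$ (i, j))"
    unfolding J_mat_conj[OF assms] using assms by (simp add: mat_eq_iff)
  then show ?thesis
    unfolding balanced_def by metis
qed

lemma associated_iff_J_mat_conj: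
  assumes "M \<in> carrier_mat m m"
  shows "associated m 0 M \<longleftrightarrow> J_mat m * M * J_mat m = - M"
proof -
  have "J_mat m * M * J_mat m = - M \<longleftrightarrow>
      (\<forall>i<m. \<forall>j<m. M $$ (m - 1 - i, m - 1 - j) = - M $$ (i, j))"
    unfolding J_mat_conj[OF assms] using assms by (simp add: mat_eq_iff)
  then show ?thesis
    unfolding associated_def by (simp add: add_eq_0_iff)
qed

section \<open>The semimagic condition\<close>

lemma ones_vec_carrier [simp]: "ones_vec m \<in> carrier_vec m"
  by (simp add: ones_vec_def)

lemma mult_ones_vec_eq_0_iff:
  assumes "A \<in> carrier_mat k m"
  shows "A *\<^sub>v ones_vec m = 0\<^sub>v k \<longleftrightarrow> (\<forall>i<k. (\<Sum>j<m. A $$ (i, j)) = 0)"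
  using assms by (auto simp: vec_eq_iff ones_vec_def scalar_prod_def lessThan_atLeast0)

lemma semimagic_0_iff:
  "semimagic m 0 M \<longleftrightarrow> M \<in> carrier_mat m m \<and>
     M *\<^sub>v ones_vec m = 0\<^sub>v m \<and> transpose_mat M *\<^sub>v ones_vec m = 0\<^sub>v m"
  by (auto simp: semimagic_def mult_ones_vec_eq_0_iff[of _ m m])

section \<open>The symmetric involution X\<close>

lemma X_mat_carrier [simp]: "X_mat n \<in> carrier_mat (2 * n) (2 * n)"
  unfolding X_mat_def mult_2 by (intro smult_carrier_mat four_block_carrier_mat) auto

lemma mult_mat_zero_vec:
  fixes A :: "real mat"
  assumes "A \<in> carrier_mat k m"
  shows "A *\<^sub>v 0\<^sub>v m = 0\<^sub>v k"
  using assms by (intro eq_vecI) simp_all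

lemma transpose_smult_mat: "transpose_mat (c \<cdot>\<^sub>m A) = c \<cdot>\<^sub>m transpose_mat A"
  by (rule eq_matI) simp_all

lemma X_mat_transpose [simp]: "transpose_mat (X_mat n) = X_mat n"
proof -
  have "transpose_mat (four_block_mat (1\<^sub>m n) (J_mat n) (J_mat n) (- 1\<^sub>m n)) =
      four_block_mat (1\<^sub>m n) (J_mat n) (J_mat n) (- 1\<^sub>m n :: real mat)"
    by (subst transpose_four_block_mat[of _ n n _ n _ n]) (auto simp: transpose_uminus)
  then show ?thesis
    by (simp add: X_mat_def transpose_smult_mat)
qed

text \<open>This explicit form serves the three matrices \<open>N\<close> whose conjugates are computed entrywise: the
  unit matrix, the block diagonal sign matrix, and the coordinates of the all-ones matrix.\<close>

lemma X_mat_conj_block_diag: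
  assumes "A \<in> carrier_mat n n" "D \<in> carrier_mat n n"
  shows "X_mat n * four_block_mat A (0\<^sub>m n n) (0\<^sub>m n n) D * X_mat n =
    (1 / 2) \<cdot>\<^sub>m four_block_mat
      (A + J_mat n * D * J_mat n) (A * J_mat n - J_mat n * D)
      (J_mat n * A - D * J_mat n) (J_mat n * A * J_mat n + D)"
  (is "?X * ?N * ?X = _ \<cdot>\<^sub>m ?R")
proof -
  let ?F = "four_block_mat (1\<^sub>m n) (J_mat n) (J_mat n) (- 1\<^sub>m n) :: real mat"
  let ?G = "four_block_mat A (J_mat n * D) (J_mat n * A) (- D)"
  have X: "?X = (1 / sqrt 2) \<cdot>\<^sub>m ?F"
    by (simp add: X_mat_def)
  have F: "?F \<in> carrier_mat (n + n) (n + n)"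
    by (rule four_block_carrier_mat) simp_all
  have N: "?N \<in> carrier_mat (n + n) (n + n)"
    by (rule four_block_carrier_mat) (use assms in simp_all)
  have G: "?G \<in> carrier_mat (n + n) (n + n)"
    by (rule four_block_carrier_mat) (use assms in simp_all)
  have JA: "J_mat n * A \<in> carrier_mat n n" and JD: "J_mat n * D \<in> carrier_mat n n"
    using assms by (auto intro: mult_carrier_mat[OF J_mat_carrier])
  have AJ: "A * J_mat n \<in> carrier_mat n n" and DJ: "D * J_mat n \<in> carrier_mat n n"
    using assms by (auto intro: mult_carrier_mat[OF _ J_mat_carrier])
  have FN: "?F * ?N = ?G"
    by (subst mult_four_block_mat[of _ n n _ n _ n _ _ n _ n]) (use assms JA JD in simp_all)
  have GF: "?G * ?F = ?R"
    by (subst mult_four_block_mat[of _ n n _ n _ n _ _ n _ n])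
      (use assms JA JD AJ DJ in \<open>simp_all add: add_uminus_minus_mat[of _ n n]\<close>)
  have "?X * ?N * ?X = ((1 / sqrt 2) \<cdot>\<^sub>m (?F * ?N)) * ?X"
    unfolding X mult_smult_assoc_mat[OF F N] ..
  also have "\<dots> = (1 / sqrt 2) \<cdot>\<^sub>m (?G * ?X)"
    unfolding FN by (rule mult_smult_assoc_mat[OF G X_mat_carrier[unfolded mult_2]])
  also have "?G * ?X = (1 / sqrt 2) \<cdot>\<^sub>m (?G * ?F)"
    unfolding X by (rule mult_smult_distrib[OF G F])
  also have "(1 / sqrt 2) \<cdot>\<^sub>m ((1 / sqrt 2) \<cdot>\<^sub>m (?G * ?F)) = (1 / 2) \<cdot>\<^sub>m ?R"
    unfolding GF by (rule eq_matI) simp_all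
  finally show ?thesis .
qed

lemma X_mat_square: "X_mat n * X_mat n = 1\<^sub>m (2 * n)"
proof -
  have "X_mat n * X_mat n = X_mat n * 1\<^sub>m (2 * n) * X_mat n"
    by (simp add: right_mult_one_mat[OF X_mat_carrier])
  also have "1\<^sub>m (2 * n) = four_block_mat (1\<^sub>m n) (0\<^sub>m n n) (0\<^sub>m n n) (1\<^sub>m n :: real mat)"
    by (simp add: mult_2)
  also have "X_mat n * \<dots> * X_mat n = (1 / 2) \<cdot>\<^sub>m four_block_mat
      (1\<^sub>m n + 1\<^sub>m n) (0\<^sub>m n n) (0\<^sub>m n n) (1\<^sub>m n + 1\<^sub>m n)"
    by (subst X_mat_conj_block_diag)
      (simp_all add: left_mult_one_mat[of _ n n] right_mult_one_mat[of _ n n] minus_r_inv_mat[of _ n n])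
  also have "\<dots> = 1\<^sub>m (2 * n)"
    by (rule eq_matI) auto
  finally show ?thesis .
qed

text \<open>The two block columns of \<open>X\<close> consist of eigenvectors of the reversal, with eigenvalues
  \<open>1\<close> and \<open>-1\<close>.\<close>

lemma J_mat_eq_X_conj:
  "J_mat (2 * n) =
    X_mat n * four_block_mat (1\<^sub>m n) (0\<^sub>m n n) (0\<^sub>m n n) (- 1\<^sub>m n) * X_mat n"
proof -
  have "X_mat n * four_block_mat (1\<^sub>m n) (0\<^sub>m n n) (0\<^sub>m n n) (- 1\<^sub>m n) * X_mat n =
      (1 / 2) \<cdot>\<^sub>m four_block_mat (0\<^sub>m n n) (J_mat n + J_mat n) (J_mat n + J_mat n) (0\<^sub>m n n)"
    by (subst X_mat_conj_block_diag)
      (auto simp: left_mult_one_mat[of _ n n] right_mult_one_mat[of _ n n]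
        intro!: arg_cong2[of _ _ _ _ smult_mat] cong_four_block_mat)
  also have "\<dots> = J_mat (2 * n)"
    by (rule eq_matI) (auto simp: J_mat_index)
  finally show ?thesis by simp
qed

lemma X_mat_cancel_left:
  assumes "A \<in> carrier_mat (2 * n) k"
  shows "X_mat n * (X_mat n * A) = A"
  using assms
  by (simp add: assoc_mult_mat[OF X_mat_carrier X_mat_carrier assms, symmetric] X_mat_square)

lemma X_mat_conj_conj:
  assumes "N \<in> carrier_mat (2 * n) (2 * n)"
  shows "X_mat n * (X_mat n * N * X_mat n) * X_mat n = N"
  using assms
  by (simp add: assoc_mult_mat[of _ "2 * n" "2 * n" _ "2 * n" _ "2 * n"] X_mat_square
      X_mat_cancel_left[of _ _ "2 * n"])

lemma X_mat_conj_inject: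
  assumes "N \<in> carrier_mat (2 * n) (2 * n)" "N' \<in> carrier_mat (2 * n) (2 * n)"
  shows "X_mat n * N * X_mat n = X_mat n * N' * X_mat n \<longleftrightarrow> N = N'"
  using X_mat_conj_conj[OF assms(1)] X_mat_conj_conj[OF assms(2)] by metis

lemma X_mat_conj_mult:
  assumes "N \<in> carrier_mat (2 * n) (2 * n)" "N' \<in> carrier_mat (2 * n) (2 * n)"
  shows "(X_mat n * N * X_mat n) * (X_mat n * N' * X_mat n) = X_mat n * (N * N') * X_mat n"
  using assms
  by (simp add: assoc_mult_mat[of _ "2 * n" "2 * n" _ "2 * n" _ "2 * n"]
      X_mat_cancel_left[of _ _ "2 * n"] mult_carrier_mat[of _ "2 * n" "2 * n" _ "2 * n"])

lemma X_mat_mult_vec_eq_0_iff: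
  assumes "v \<in> carrier_vec (2 * n)"
  shows "X_mat n *\<^sub>v v = 0\<^sub>v (2 * n) \<longleftrightarrow> v = 0\<^sub>v (2 * n)"
proof
  assume "X_mat n *\<^sub>v v = 0\<^sub>v (2 * n)"
  then have "X_mat n * X_mat n *\<^sub>v v = X_mat n *\<^sub>v 0\<^sub>v (2 * n)"
    using assms by (simp add: assoc_mult_mat_vec[OF X_mat_carrier X_mat_carrier])
  then show "v = 0\<^sub>v (2 * n)"
    using assms by (simp add: X_mat_square mult_mat_zero_vec[OF X_mat_carrier])
qed (simp add: mult_mat_zero_vec[OF X_mat_carrier])

section \<open>The conditions on M in terms of the blocks of N\<close>

lemma smult_mat_mult_vec:
  fixes A :: "real mat"
  assumes "A \<in> carrier_mat k m" "v \<in> carrier_vec m"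
  shows "(c \<cdot>\<^sub>m A) *\<^sub>v v = c \<cdot>\<^sub>v (A *\<^sub>v v)"
  using assms by (intro eq_vecI) simp_all

lemma J_mat_mult_ones: "J_mat m *\<^sub>v ones_vec m = ones_vec m"
proof (rule eq_vecI)
  fix i
  assume "i < dim_vec (ones_vec m)"
  then have i: "i < m" by (simp add: ones_vec_def)
  then have "(J_mat m *\<^sub>v ones_vec m) $ i = (\<Sum>l = 0..<m. if l = m - 1 - i then 1 else 0)"
    by (auto simp: ones_vec_def scalar_prod_def J_mat_index intro!: sum.cong simp del: sum.delta)
  also have "\<dots> = 1"
    using i by (subst sum.delta) auto
  finally show "(J_mat m *\<^sub>v ones_vec m) $ i = ones_vec m $ i"
    using i by (simp add: ones_vec_def)
qed (simp add: ones_vec_def)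

text \<open>The all-ones vector is symmetric, so only the first block of its \<open>X\<close>-coordinates survives.\<close>

lemma X_mat_mult_ones:
  "X_mat n *\<^sub>v ones_vec (2 * n) = sqrt 2 \<cdot>\<^sub>v (ones_vec n @\<^sub>v 0\<^sub>v n)"
proof -
  let ?F = "four_block_mat (1\<^sub>m n) (J_mat n) (J_mat n) (- 1\<^sub>m n) :: real mat"
  have F: "?F \<in> carrier_mat (n + n) (n + n)"
    by (rule four_block_carrier_mat) simp_all
  have ones: "ones_vec (2 * n) = ones_vec n @\<^sub>v ones_vec n"
    by (rule eq_vecI) (simp_all add: ones_vec_def)
  have "?F *\<^sub>v (ones_vec n @\<^sub>v ones_vec n) =
      (ones_vec n + ones_vec n) @\<^sub>v (ones_vec n + - ones_vec n)"
    by (subst four_block_mat_mult_vec[of _ n n _ n _ n])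
      (simp_all add: J_mat_mult_ones carrier_vecD[OF ones_vec_carrier])
  then have "X_mat n *\<^sub>v ones_vec (2 * n) =
      (1 / sqrt 2) \<cdot>\<^sub>v ((ones_vec n + ones_vec n) @\<^sub>v (ones_vec n + - ones_vec n))"
    unfolding X_mat_def ones
    using smult_mat_mult_vec[OF F append_carrier_vec[OF ones_vec_carrier ones_vec_carrier]]
    by simp
  also have "\<dots> = sqrt 2 \<cdot>\<^sub>v (ones_vec n @\<^sub>v 0\<^sub>v n)"
    by (rule eq_vecI) (auto simp: ones_vec_def real_div_sqrt)
  finally show ?thesis .
qed

lemma smult_vec_eq_0_iff:
  fixes v :: "real vec"
  assumes "c \<noteq> 0"
  shows "c \<cdot>\<^sub>v v = 0\<^sub>v m \<longleftrightarrow> v = 0\<^sub>v m"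
  using assms by (auto simp: vec_eq_iff)

lemma X_mat_conj_mult_ones_eq_0_iff:
  assumes "A \<in> carrier_mat n n" "B \<in> carrier_mat n n"
    "C \<in> carrier_mat n n" "D \<in> carrier_mat n n"
  shows "(X_mat n * four_block_mat A B C D * X_mat n) *\<^sub>v ones_vec (2 * n) = 0\<^sub>v (2 * n) \<longleftrightarrow>
    A *\<^sub>v ones_vec n = 0\<^sub>v n \<and> C *\<^sub>v ones_vec n = 0\<^sub>v n"
proof -
  let ?N = "four_block_mat A B C D"
  let ?e = "ones_vec n @\<^sub>v 0\<^sub>v n"
  have N: "?N \<in> carrier_mat (2 * n) (2 * n)"
    unfolding mult_2 by (rule four_block_carrier_mat) (use assms in simp_all)
  have e: "?e \<in> carrier_vec (2 * n)"
    unfolding mult_2 by (rule append_carrier_vec) simp_all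
  have XN: "X_mat n * ?N \<in> carrier_mat (2 * n) (2 * n)"
    by (rule mult_carrier_mat[OF X_mat_carrier N])
  have "(X_mat n * ?N * X_mat n) *\<^sub>v ones_vec (2 * n) =
      X_mat n *\<^sub>v (?N *\<^sub>v (X_mat n *\<^sub>v ones_vec (2 * n)))"
    using assoc_mult_mat_vec[OF XN X_mat_carrier ones_vec_carrier]
      assoc_mult_mat_vec[OF X_mat_carrier N, of "X_mat n *\<^sub>v ones_vec (2 * n)"]
    by (simp add: mult_mat_vec_carrier[OF X_mat_carrier])
  also have "\<dots> = X_mat n *\<^sub>v (sqrt 2 \<cdot>\<^sub>v (?N *\<^sub>v ?e))"
    unfolding X_mat_mult_ones mult_mat_vec[OF N e] ..
  also have "?N *\<^sub>v ?e = (A *\<^sub>v ones_vec n) @\<^sub>v (C *\<^sub>v ones_vec n)"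
    using assms
    by (subst four_block_mat_mult_vec[of _ n n _ n _ n])
      (simp_all add: mult_mat_zero_vec[of _ n n])
  finally have eq: "(X_mat n * ?N * X_mat n) *\<^sub>v ones_vec (2 * n) =
      X_mat n *\<^sub>v (sqrt 2 \<cdot>\<^sub>v ((A *\<^sub>v ones_vec n) @\<^sub>v (C *\<^sub>v ones_vec n)))" .
  have zero: "0\<^sub>v (2 * n) = 0\<^sub>v n @\<^sub>v (0\<^sub>v n :: real vec)"
    by (rule eq_vecI) simp_all
  have "sqrt 2 \<cdot>\<^sub>v ((A *\<^sub>v ones_vec n) @\<^sub>v (C *\<^sub>v ones_vec n)) \<in> carrier_vec (2 * n)"
    unfolding mult_2 using assms by (auto intro!: append_carrier_vec mult_mat_vec_carrier)
  then have "(X_mat n * ?N * X_mat n) *\<^sub>v ones_vec (2 * n) = 0\<^sub>v (2 * n) \<longleftrightarrow>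
      (A *\<^sub>v ones_vec n) @\<^sub>v (C *\<^sub>v ones_vec n) = 0\<^sub>v (2 * n)"
    unfolding eq by (simp add: X_mat_mult_vec_eq_0_iff smult_vec_eq_0_iff)
  also have "\<dots> \<longleftrightarrow> A *\<^sub>v ones_vec n = 0\<^sub>v n \<and> C *\<^sub>v ones_vec n = 0\<^sub>v n"
    unfolding zero using assms by (intro append_vec_eq[of _ n]) simp_all
  finally show ?thesis .
qed

text \<open>The column sums are the row sums of the transpose. Since \<open>X\<close> is symmetric, transposing acts on
  the inner matrix alone and exchanges the roles of \<open>B\<close> and \<open>C\<close>.\<close>

lemma semimagic_X_mat_conj_iff:
  assumes "A \<in> carrier_mat n n" "B \<in> carrier_mat n n"
    "C \<in> carrier_mat n n" "D \<in> carrier_mat n n"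
  shows "semimagic (2 * n) 0 (X_mat n * four_block_mat A B C D * X_mat n) \<longleftrightarrow>
    A *\<^sub>v ones_vec n = 0\<^sub>v n \<and> C *\<^sub>v ones_vec n = 0\<^sub>v n \<and>
    transpose_mat A *\<^sub>v ones_vec n = 0\<^sub>v n \<and> transpose_mat B *\<^sub>v ones_vec n = 0\<^sub>v n"
proof -
  let ?N = "four_block_mat A B C D"
  have N: "?N \<in> carrier_mat (2 * n) (2 * n)"
    unfolding mult_2 by (rule four_block_carrier_mat) (use assms in simp_all)
  have XN: "X_mat n * ?N \<in> carrier_mat (2 * n) (2 * n)"
    by (rule mult_carrier_mat[OF X_mat_carrier N])
  have XNX: "X_mat n * ?N * X_mat n \<in> carrier_mat (2 * n) (2 * n)"
    by (rule mult_carrier_mat[OF XN X_mat_carrier])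
  have "transpose_mat (X_mat n * ?N * X_mat n) = X_mat n * (transpose_mat ?N * X_mat n)"
    by (simp only: transpose_mult[OF XN X_mat_carrier] transpose_mult[OF X_mat_carrier N]
        X_mat_transpose)
  also have "\<dots> = X_mat n * transpose_mat ?N * X_mat n"
    by (rule assoc_mult_mat[symmetric, OF X_mat_carrier _ X_mat_carrier])
      (rule transpose_carrier_mat[THEN iffD2, OF N])
  also have "transpose_mat ?N =
      four_block_mat (transpose_mat A) (transpose_mat C) (transpose_mat B) (transpose_mat D)"
    by (rule transpose_four_block_mat[OF assms])
  finally have "transpose_mat (X_mat n * ?N * X_mat n) = X_mat n *
      four_block_mat (transpose_mat A) (transpose_mat C) (transpose_mat B) (transpose_mat D) *
      X_mat n" .
  then show ?thesis
    unfolding semimagic_0_iff using XNX assms by (auto simp: X_mat_conj_mult_ones_eq_0_iff)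
qed

lemma four_block_mat_eq_iff:
  assumes "A \<in> carrier_mat n n" "B \<in> carrier_mat n n"
    "C \<in> carrier_mat n n" "D \<in> carrier_mat n n"
    "A' \<in> carrier_mat n n" "B' \<in> carrier_mat n n"
    "C' \<in> carrier_mat n n" "D' \<in> carrier_mat n n"
  shows "four_block_mat A B C D = four_block_mat A' B' C' D' \<longleftrightarrow>
    A = A' \<and> B = B' \<and> C = C' \<and> D = D'"
proof
  assume eq: "four_block_mat A B C D = four_block_mat A' B' C' D'"
  have entry: "four_block_mat A B C D $$ (i, j) = four_block_mat A' B' C' D' $$ (i, j)" for i j
    by (simp only: eq)
  have "A $$ (i, j) = A' $$ (i, j)" "B $$ (i, j) = B' $$ (i, j)"
    "C $$ (i, j) = C' $$ (i, j)" "D $$ (i, j) = D' $$ (i, j)" if "i < n" "j < n" for i j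
    using entry[of i j] entry[of i "n + j"] entry[of "n + i" j] entry[of "n + i" "n + j"] that assms
    by simp_all
  then show "A = A' \<and> B = B' \<and> C = C' \<and> D = D'"
    using assms by (auto intro!: eq_matI)
qed simp

lemma mat_eq_uminus_iff:
  fixes A :: "real mat"
  assumes "A \<in> carrier_mat k m"
  shows "- A = A \<longleftrightarrow> A = 0\<^sub>m k m" "A = - A \<longleftrightarrow> A = 0\<^sub>m k m"
  using assms by (auto simp: mat_eq_iff)

text \<open>The reversal becomes the block diagonal sign matrix in \<open>X\<close>-coordinates, so conjugating by it
  amounts to changing the sign of the off-diagonal blocks.\<close>

lemma J_mat_conj_X_mat_conj:
  assumes "A \<in> carrier_mat n n" "B \<in> carrier_mat n n"
    "C \<in> carrier_mat n n" "D \<in> carrier_mat n n"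
  shows "J_mat (2 * n) * (X_mat n * four_block_mat A B C D * X_mat n) * J_mat (2 * n) =
    X_mat n * four_block_mat A (- B) (- C) D * X_mat n"
proof -
  let ?N = "four_block_mat A B C D"
  let ?S = "four_block_mat (1\<^sub>m n) (0\<^sub>m n n) (0\<^sub>m n n) (- 1\<^sub>m n) :: real mat"
  have N: "?N \<in> carrier_mat (2 * n) (2 * n)"
    unfolding mult_2 by (rule four_block_carrier_mat) (use assms in simp_all)
  have S: "?S \<in> carrier_mat (2 * n) (2 * n)"
    unfolding mult_2 by (rule four_block_carrier_mat) simp_all
  have "?S * ?N = four_block_mat A B (- C) (- D)"
    using assms by (subst mult_four_block_mat[of _ n n _ n _ n _ _ n _ n]) simp_all
  also have "\<dots> * ?S = four_block_mat A (- B) (- C) D"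
    using assms by (subst mult_four_block_mat[of _ n n _ n _ n _ _ n _ n]) simp_all
  finally have "?S * ?N * ?S = four_block_mat A (- B) (- C) D" .
  then show ?thesis
    unfolding J_mat_eq_X_conj X_mat_conj_mult[OF S N]
      X_mat_conj_mult[OF mult_carrier_mat[OF S N] S] by simp
qed

lemma balanced_X_mat_conj_iff:
  assumes "A \<in> carrier_mat n n" "B \<in> carrier_mat n n"
    "C \<in> carrier_mat n n" "D \<in> carrier_mat n n"
  shows "balanced (2 * n) (X_mat n * four_block_mat A B C D * X_mat n) \<longleftrightarrow>
    B = 0\<^sub>m n n \<and> C = 0\<^sub>m n n"
proof -
  have carrier: "four_block_mat P Q R S \<in> carrier_mat (2 * n) (2 * n)"
    if "P \<in> carrier_mat n n" "S \<in> carrier_mat n n" for P Q R S :: "real mat"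
    unfolding mult_2 by (rule four_block_carrier_mat[OF that])
  have "X_mat n * four_block_mat A B C D * X_mat n \<in> carrier_mat (2 * n) (2 * n)"
    by (intro mult_carrier_mat[of _ "2 * n" "2 * n"] X_mat_carrier carrier assms)
  then have "balanced (2 * n) (X_mat n * four_block_mat A B C D * X_mat n) \<longleftrightarrow>
      four_block_mat A (- B) (- C) D = four_block_mat A B C D"
    by (simp only: balanced_iff_J_mat_conj J_mat_conj_X_mat_conj[OF assms]
        X_mat_conj_inject carrier assms)
  also have "\<dots> \<longleftrightarrow> - B = B \<and> - C = C"
    using assms by (subst four_block_mat_eq_iff[of _ n]) simp_all
  finally show ?thesis
    using assms by (simp add: mat_eq_uminus_iff[of _ n n])
qed

lemma associated_X_mat_conj_iff:
  assumes "A \<in> carrier_mat n n" "B \<in> carrier_mat n n"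
    "C \<in> carrier_mat n n" "D \<in> carrier_mat n n"
  shows "associated (2 * n) 0 (X_mat n * four_block_mat A B C D * X_mat n) \<longleftrightarrow>
    A = 0\<^sub>m n n \<and> D = 0\<^sub>m n n"
proof -
  have carrier: "four_block_mat P Q R S \<in> carrier_mat (2 * n) (2 * n)"
    if "P \<in> carrier_mat n n" "S \<in> carrier_mat n n" for P Q R S :: "real mat"
    unfolding mult_2 by (rule four_block_carrier_mat[OF that])
  let ?N = "four_block_mat A B C D"
  have N: "?N \<in> carrier_mat (2 * n) (2 * n)"
    by (intro carrier assms)
  have XN: "X_mat n * ?N \<in> carrier_mat (2 * n) (2 * n)"
    by (rule mult_carrier_mat[OF X_mat_carrier N])
  have XNX: "X_mat n * ?N * X_mat n \<in> carrier_mat (2 * n) (2 * n)"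
    by (rule mult_carrier_mat[OF XN X_mat_carrier])
  \<comment> \<open>Negation commutes with conjugation by \<open>X\<close>, so both sides can be compared blockwise.\<close>
  have "- ?N = four_block_mat (- A) (- B) (- C) (- D)"
    using assms by (intro eq_matI) auto
  moreover have "- (X_mat n * ?N * X_mat n) = X_mat n * (- ?N) * X_mat n"
    using carrier_matD[OF XN] carrier_matD[OF N] carrier_matD[OF X_mat_carrier, of n]
    by (simp only: uminus_mult_left_mat uminus_mult_right_mat)
  ultimately have "- (X_mat n * ?N * X_mat n) =
      X_mat n * four_block_mat (- A) (- B) (- C) (- D) * X_mat n"
    by simp
  then have "associated (2 * n) 0 (X_mat n * ?N * X_mat n) \<longleftrightarrow>
      four_block_mat A (- B) (- C) D = four_block_mat (- A) (- B) (- C) (- D)"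
    using assms
    by (simp only: associated_iff_J_mat_conj[OF XNX] J_mat_conj_X_mat_conj[OF assms]
        X_mat_conj_inject carrier uminus_carrier_iff_mat)
  also have "\<dots> \<longleftrightarrow> A = - A \<and> D = - D"
    using assms by (subst four_block_mat_eq_iff[of _ n]) simp_all
  finally show ?thesis
    using assms by (simp add: mat_eq_uminus_iff[of _ n n])
qed

text \<open>Since conjugation by \<open>X\<close> is its own inverse, the blocks of \<open>X * M * X\<close> are coordinates for \<open>M\<close>;
  this provides the witnesses in the forward directions of the theorem.\<close>

lemma obtain_X_mat_blocks:
  assumes "M \<in> carrier_mat (2 * n) (2 * n)"
  obtains A B C D where "A \<in> carrier_mat n n" "B \<in> carrier_mat n n"
    "C \<in> carrier_mat n n" "D \<in> carrier_mat n n"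
    "M = X_mat n * four_block_mat A B C D * X_mat n"
proof -
  let ?N = "X_mat n * M * X_mat n"
  have dim: "dim_row ?N = n + n" "dim_col ?N = n + n"
    using carrier_matD[OF X_mat_carrier, of n] by simp_all
  obtain A B C D where "split_block ?N n n = (A, B, C, D)"
    by (metis prod_cases4)
  note split = split_block[OF this dim]
  have "M = X_mat n * ?N * X_mat n"
    by (rule X_mat_conj_conj[OF assms, symmetric])
  also have "?N = four_block_mat A B C D"
    by (rule split(5))
  finally show thesis
    by (rule that[OF split(1-4)])
qed

section \<open>The decomposition\<close>

lemma ones_mat_eq_X_mat_conj:
  "ones_mat (2 * n) =
    X_mat n * four_block_mat (2 \<cdot>\<^sub>m ones_mat n) (0\<^sub>m n n) (0\<^sub>m n n) (0\<^sub>m n n) * X_mat n"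
proof -
  let ?E = "2 \<cdot>\<^sub>m ones_mat n"
  have E: "?E \<in> carrier_mat n n"
    by (simp add: ones_mat_def)
  have JE: "J_mat n * ?E = ?E"
    unfolding J_mat_mult[OF E] by (rule eq_matI) (simp_all add: ones_mat_def)
  have EJ: "?E * J_mat n = ?E"
    unfolding mult_J_mat[OF E] by (rule eq_matI) (simp_all add: ones_mat_def)
  have minus_0: "?E - 0\<^sub>m n n = ?E"
    by (rule eq_matI) (simp_all add: ones_mat_def)
  have "X_mat n * four_block_mat ?E (0\<^sub>m n n) (0\<^sub>m n n) (0\<^sub>m n n) * X_mat n =
      (1 / 2) \<cdot>\<^sub>m four_block_mat ?E ?E ?E ?E"
    using E by (subst X_mat_conj_block_diag)
      (simp_all add: JE EJ minus_0)
  also have "\<dots> = ones_mat (2 * n)"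
    by (rule eq_matI) (auto simp: ones_mat_def)
  finally show ?thesis by simp
qed

theorem theorem1:
  fixes n :: nat and M :: "real mat"
  assumes "M \<in> carrier_mat (2 * n) (2 * n)"
  shows "(M \<in> A0 (2 * n) \<longleftrightarrow>
      (\<exists>V W. V \<in> carrier_mat n n \<and> W \<in> carrier_mat n n \<and>
        V *\<^sub>v ones_vec n = 0\<^sub>v n \<and> W *\<^sub>v ones_vec n = 0\<^sub>v n \<and>
        M = X_mat n * four_block_mat (0\<^sub>m n n) (transpose_mat V) W (0\<^sub>m n n) * X_mat n))
    \<and> (M \<in> B0 (2 * n) \<longleftrightarrow>
      (\<exists>Y Z. Y \<in> S0 n \<and> Z \<in> carrier_mat n n \<and>
        M = X_mat n * four_block_mat Y (0\<^sub>m n n) (0\<^sub>m n n) Z * X_mat n))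
    \<and> ones_mat (2 * n) =
        X_mat n * four_block_mat (2 \<cdot>\<^sub>m ones_mat n) (0\<^sub>m n n) (0\<^sub>m n n) (0\<^sub>m n n) * X_mat n"
proof (intro conjI iffI)
  assume "M \<in> A0 (2 * n)"
  then have M: "semimagic (2 * n) 0 M" "associated (2 * n) 0 M"
    by (simp_all add: A0_def)
  obtain A B C D where blocks: "A \<in> carrier_mat n n" "B \<in> carrier_mat n n"
      "C \<in> carrier_mat n n" "D \<in> carrier_mat n n"
    and eq: "M = X_mat n * four_block_mat A B C D * X_mat n"
    by (rule obtain_X_mat_blocks[OF assms])
  from M have "A = 0\<^sub>m n n" "D = 0\<^sub>m n n"
      "transpose_mat B *\<^sub>v ones_vec n = 0\<^sub>v n" "C *\<^sub>v ones_vec n = 0\<^sub>v n"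
    unfolding eq semimagic_X_mat_conj_iff[OF blocks] associated_X_mat_conj_iff[OF blocks]
    by blast+
  then show "\<exists>V W. V \<in> carrier_mat n n \<and> W \<in> carrier_mat n n \<and>
      V *\<^sub>v ones_vec n = 0\<^sub>v n \<and> W *\<^sub>v ones_vec n = 0\<^sub>v n \<and>
      M = X_mat n * four_block_mat (0\<^sub>m n n) (transpose_mat V) W (0\<^sub>m n n) * X_mat n"
    using blocks eq by (intro exI[of _ "transpose_mat B"] exI[of _ C]) simp
next
  assume "\<exists>V W. V \<in> carrier_mat n n \<and> W \<in> carrier_mat n n \<and>
      V *\<^sub>v ones_vec n = 0\<^sub>v n \<and> W *\<^sub>v ones_vec n = 0\<^sub>v n \<and>
      M = X_mat n * four_block_mat (0\<^sub>m n n) (transpose_mat V) W (0\<^sub>m n n) * X_mat n"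
  then obtain V W where VW: "V \<in> carrier_mat n n" "W \<in> carrier_mat n n"
      "V *\<^sub>v ones_vec n = 0\<^sub>v n" "W *\<^sub>v ones_vec n = 0\<^sub>v n"
    and eq: "M = X_mat n * four_block_mat (0\<^sub>m n n) (transpose_mat V) W (0\<^sub>m n n) * X_mat n"
    by blast
  have "0\<^sub>m n n *\<^sub>v ones_vec n = (0\<^sub>v n :: real vec)"
    by (rule eq_vecI) simp_all
  then show "M \<in> A0 (2 * n)"
    using VW unfolding A0_def eq
    by (simp add: semimagic_X_mat_conj_iff associated_X_mat_conj_iff)
next
  assume "M \<in> B0 (2 * n)"
  then have M: "semimagic (2 * n) 0 M" "balanced (2 * n) M"
    by (simp_all add: B0_def)
  obtain A B C D where blocks: "A \<in> carrier_mat n n" "B \<in> carrier_mat n n"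
      "C \<in> carrier_mat n n" "D \<in> carrier_mat n n"
    and eq: "M = X_mat n * four_block_mat A B C D * X_mat n"
    by (rule obtain_X_mat_blocks[OF assms])
  from M have "B = 0\<^sub>m n n" "C = 0\<^sub>m n n"
      "A *\<^sub>v ones_vec n = 0\<^sub>v n" "transpose_mat A *\<^sub>v ones_vec n = 0\<^sub>v n"
    unfolding eq semimagic_X_mat_conj_iff[OF blocks] balanced_X_mat_conj_iff[OF blocks]
    by blast+
  then show "\<exists>Y Z. Y \<in> S0 n \<and> Z \<in> carrier_mat n n \<and>
      M = X_mat n * four_block_mat Y (0\<^sub>m n n) (0\<^sub>m n n) Z * X_mat n"
    using blocks eq by (intro exI[of _ A] exI[of _ D]) (simp add: S0_def semimagic_0_iff)
next
  assume "\<exists>Y Z. Y \<in> S0 n \<and> Z \<in> carrier_mat n n \<and>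
      M = X_mat n * four_block_mat Y (0\<^sub>m n n) (0\<^sub>m n n) Z * X_mat n"
  then obtain Y Z where YZ: "Y \<in> S0 n" "Z \<in> carrier_mat n n"
    and eq: "M = X_mat n * four_block_mat Y (0\<^sub>m n n) (0\<^sub>m n n) Z * X_mat n"
    by blast
  have "0\<^sub>m n n *\<^sub>v ones_vec n = (0\<^sub>v n :: real vec)"
    by (rule eq_vecI) simp_all
  then show "M \<in> B0 (2 * n)"
    using YZ unfolding B0_def eq S0_def
    by (simp add: semimagic_X_mat_conj_iff balanced_X_mat_conj_iff semimagic_0_iff[of n])
qed (rule ones_mat_eq_X_mat_conj)

end
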